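(* Assume $\mathfrak{p}\mid2$ and $L$ has Gram matrix $G=\operatorname{diag}(1,\alpha)$ with $\alpha\in\mathcal{O}$ (notation in the context). If $\mathfrak{t}_m\geq\operatorname{ord}_\mathfrak{p}(\alpha)+e+1$, then $\beta_{\mathfrak{p}}^{+}(X;X)=N(\mathfrak{p})^{-\mathfrak{t}_m+\min(\mathfrak{t}_m,\mathfrak{t}_\nu,\mathfrak{t}_s)}$.
   Context: $K$ is a finite extension of $\mathbb{Q}_p$ with ring of integers $\mathcal{O}$, maximal ideal $\mathfrak{p}$, uniformizer $\pi$, normalized valuation $\operatorname{ord}_\mathfrak{p}$ ($\operatorname{ord}_\mathfrak{p}(0)=\infty$), $e=\operatorname{ord}_\mathfrak{p}(2)$, $N(\mathfrak{p})=|\mathcal{O}/\mathfrak{p}|$. $L$ is a lattice in a $2$-dimensional quadratic space over $K$ with basis $\{e_1,e_2\}$ and Gram matrix $G=\operatorname{diag}(1,\alpha)$. $X=L+\nu$ with $\nu=(s_1e_1+s_2e_2)/\pi^{\mathfrak{t}_m}$, $\mathfrak{t}_m\in\mathbb{Z}$, $s_1,s_2\in\mathcal{O}$, at least one a unit; $\mathfrak{t}_\nu=\operatorname{ord}_\mathfrak{p}(s_1^2+\alpha s_2^2)$, $\mathfrak{t}_s=\operatorname{ord}_\mathfrak{p}(s_1)$. Put $\mathfrak{t}_L=e$. For $t\geq\max(\mathfrak{t}_m,\mathfrak{t}_L+1)$, $O^{+}(X,\mathfrak{p}^t)=\{M\in\mathrm{GL}_2(\mathcal{O}/\mathfrak{p}^t):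 M^TGM\equiv G,\ \det M\equiv1\pmod{\mathfrak{p}^{t+\mathfrak{t}_L}},\ M\binom{s_1}{s_2}\equiv\binom{s_1}{s_2}\pmod{\mathfrak{p}^{\mathfrak{t}_m}}\}$, and $\beta_{\mathfrak{p}}^{+}(X;X)=\lim_{t\to\infty}|O^{+}(X,\mathfrak{p}^t)|/N(\mathfrak{p})^t$. *)

theory Defs
  imports "HOL-Analysis.Analysis"
begin

text \<open>
  Valuations take values in \<^typ>\<open>ereal\<close>: integers on nonzero elements, and \<open>\<infinity>\<close> at \<open>0\<close>.
\<close>

locale normalized_valuation =
  fixes ord :: "'a::field \<Rightarrow> ereal"
  assumes ord_eq_infinity_iff: "ord x = \<infinity> \<longleftrightarrow> x = 0"
    and ord_int: "x \<noteq> 0 \<Longrightarrow> \<exists>n::int. ord x = ereal (of_int n)"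
    and ord_mult: "ord (x * y) = ord x + ord y"
    and ord_add: "min (ord x) (ord y) \<le> ord (x + y)"
    and ord_normalized: "\<exists>x. ord x = 1"

text \<open>
  The field \<open>\<rat>\<^sub>p\<close>, given as the completion of \<open>\<rat>\<close> for the \<open>p\<close>-adic valuation. Since \<open>p\<close> is prime,
  \<open>v p = 1\<close> forces \<open>v\<close> to be the \<open>p\<close>-adic valuation on \<open>\<rat>\<close>.
\<close>

locale padic_numbers = normalized_valuation v
  for v :: "'q::field_char_0 \<Rightarrow> ereal" +
  fixes p :: nat
  assumes prime_p: "prime p"
    and v_p: "v (of_nat p) = 1"
    and rationals_dense: "\<exists>r::rat. ereal (real n) \<le> v (x - of_rat r)"
    and complete:
      "(\<And>n::nat. \<exists>i0::nat. \<forall>i\<ge>i0. \<forall>j\<ge>i0. ereal (real n) \<le> v (f i - f j)) \<Longrightarrow>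
       \<exists>x. \<forall>n::nat. \<exists>i0. \<forall>i\<ge>i0. ereal (real n) \<le> v (f i - x)"

text \<open>
  A finite extension \<open>K = 'k\<close> of \<open>\<rat>\<^sub>p = 'q\<close>, embedded by \<open>\<iota>\<close>, with its normalized valuation: \<open>ord\<close> extends
  a multiple of \<open>v\<close> (the factor is the ramification index) and takes the value \<open>1\<close>.
\<close>

locale padic_field = padic_numbers v p + normalized_valuation ord
  for v :: "'q::field_char_0 \<Rightarrow> ereal" and p :: nat and ord :: "'k::field \<Rightarrow> ereal" +
  fixes \<iota> :: "'q \<Rightarrow> 'k"
  assumes embed_one: "\<iota> 1 = 1"
    and embed_add: "\<iota> (x + y) = \<iota> x + \<iota> y"
    and embed_mult: "\<iota> (x * y) = \<iota> x * \<iota> y"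
    and finite_degree: "\<exists>S. finite S \<and> module.span (\<lambda>c x. \<iota> c * x) S = (UNIV :: 'k set)"
    and ord_extends: "\<exists>c>0. \<forall>x. ord (\<iota> x) = ereal c * v x"

definition integer_ring :: "('k::field \<Rightarrow> ereal) \<Rightarrow> 'k set" where
  "integer_ring ord = {x. 0 \<le> ord x}"

text \<open>Congruence modulo \<open>\<pp>\<^sup>t\<close>, where \<open>\<pp>\<^sup>t = {x. t \<le> ord x}\<close>.\<close>

definition cong_pow :: "('k::field \<Rightarrow> ereal) \<Rightarrow> ereal \<Rightarrow> 'k \<Rightarrow> 'k \<Rightarrow> bool" where
  "cong_pow ord t x y \<longleftrightarrow> t \<le> ord (x - y)"

definition residue_class :: "('k::field \<Rightarrow> ereal) \<Rightarrow> ereal \<Rightarrow> 'k \<Rightarrow> 'k set" where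
  "residue_class ord t x = {y. cong_pow ord t y x}"

definition norm_p :: "('k::field \<Rightarrow> ereal) \<Rightarrow> nat" where
  "norm_p ord = card (residue_class ord 1 ` integer_ring ord)"

definition vec_cong :: "('k::field \<Rightarrow> ereal) \<Rightarrow> ereal \<Rightarrow> 'k^2 \<Rightarrow> 'k^2 \<Rightarrow> bool" where
  "vec_cong ord t x y \<longleftrightarrow> (\<forall>i. cong_pow ord t (x $ i) (y $ i))"

definition mat_cong :: "('k::field \<Rightarrow> ereal) \<Rightarrow> ereal \<Rightarrow> 'k^2^2 \<Rightarrow> 'k^2^2 \<Rightarrow> bool" where
  "mat_cong ord t A B \<longleftrightarrow> (\<forall>i j. cong_pow ord t (A $ i $ j) (B $ i $ j))"

definition integral_matrices :: "('k::field \<Rightarrow> ereal) \<Rightarrow> ('k^2^2) set" where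
  "integral_matrices ord = {M. \<forall>i j. M $ i $ j \<in> integer_ring ord}"

text \<open>A matrix over \<open>\<O>/\<pp>\<^sup>t\<close> has as entries cosets of \<open>\<pp>\<^sup>t\<close>.\<close>

definition mat_reduce :: "('k::field \<Rightarrow> ereal) \<Rightarrow> ereal \<Rightarrow> 'k^2^2 \<Rightarrow> 'k set^2^2" where
  "mat_reduce ord t M = (\<chi> i j. residue_class ord t (M $ i $ j))"

definition GL2_mod :: "('k::field \<Rightarrow> ereal) \<Rightarrow> ereal \<Rightarrow> ('k set^2^2) set" where
  "GL2_mod ord t =
     {mat_reduce ord t M | M. M \<in> integral_matrices ord \<and>
        (\<exists>M' \<in> integral_matrices ord.
           mat_cong ord t (M ** M') (mat 1) \<and> mat_cong ord t (M' ** M) (mat 1))}"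

definition gram_matrix :: "('v::ab_group_add \<Rightarrow> 'v \<Rightarrow> 'k::field) \<Rightarrow> 'v \<Rightarrow> 'v \<Rightarrow> 'k^2^2" where
  "gram_matrix B e1 e2 = vector [vector [B e1 e1, B e1 e2], vector [B e2 e1, B e2 e2]]"

definition diag2 :: "'k::field \<Rightarrow> 'k \<Rightarrow> 'k^2^2" where
  "diag2 a b = vector [vector [a, 0], vector [0, b]]"

text \<open>
  A lattice coset \<open>X = L + \<nu>\<close> in a binary quadratic space \<open>(V, B)\<close> over \<open>K\<close>, with \<open>L = \<O> e1 + \<O> e2\<close> and
  \<open>\<nu> = (s1 e1 + s2 e2) / \<pi>\<^bsup>tm\<^esup>\<close>. The quadratic form is \<open>x \<mapsto> B x x\<close>.
\<close>

locale binary_lattice_coset = padic_field v p ord \<iota> + vector_space scale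
  for v :: "'q::field_char_0 \<Rightarrow> ereal" and p :: nat and ord :: "'k::field \<Rightarrow> ereal"
    and \<iota> :: "'q \<Rightarrow> 'k" and scale :: "'k \<Rightarrow> 'v::ab_group_add \<Rightarrow> 'v" +
  fixes B :: "'v \<Rightarrow> 'v \<Rightarrow> 'k" and e1 e2 :: 'v and L X :: "'v set" and \<nu> :: 'v
    and \<pi> :: 'k and tm :: int and s1 s2 :: 'k
  assumes B_sym: "B x y = B y x"
    and B_add: "B (x + y) z = B x z + B y z"
    and B_scale: "B (scale c x) y = c * B x y"
    and basis_distinct: "e1 \<noteq> e2"
    and basis_independent: "independent {e1, e2}"
    and basis_span: "span {e1, e2} = UNIV"
    and L_eq: "L = {scale a e1 + scale b e2 | a b. a \<in> integer_ring ord \<and> b \<in> integer_ring ord}"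
    and uniformizer: "ord \<pi> = 1"
    and s_integral: "s1 \<in> integer_ring ord" "s2 \<in> integer_ring ord"
    and s_unit: "ord s1 = 0 \<or> ord s2 = 0"
    and \<nu>_eq: "\<nu> = scale (\<pi> powi (- tm)) (scale s1 e1 + scale s2 e2)"
    and X_eq: "X = {x + \<nu> | x. x \<in> L}"

text \<open>
  The set \<open>O\<^sup>+(X, \<pp>\<^sup>t)\<close> for the Gram matrix \<open>G\<close> of \<open>L\<close> and \<open>\<nu> = (s1 e1 + s2 e2) / \<pi>\<^bsup>tm\<^esup>\<close>.
  The congruences modulo \<open>\<pp>\<^bsup>t + tL\<^esup>\<close>, where \<open>tL = ord 2\<close>, do not depend only on the class of \<open>M\<close>
  modulo \<open>\<pp>\<^sup>t\<close>, so they are read as conditions on a common integral representative of the class.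
  Only \<open>t \<ge> max tm (tL + 1)\<close> is meaningful.
\<close>

definition special_orthogonal_mod ::
  "('k::field \<Rightarrow> ereal) \<Rightarrow> 'k^2^2 \<Rightarrow> 'k \<Rightarrow> 'k \<Rightarrow> int \<Rightarrow> nat \<Rightarrow> ('k set^2^2) set" where
  "special_orthogonal_mod ord G s1 s2 tm t =
     {A \<in> GL2_mod ord (ereal (real t)).
        \<exists>M \<in> integral_matrices ord.
          A = mat_reduce ord (ereal (real t)) M \<and>
          mat_cong ord (ereal (real t) + ord 2) (transpose M ** G ** M) G \<and>
          cong_pow ord (ereal (real t) + ord 2) (det M) 1 \<and>
          vec_cong ord (ereal (of_int tm)) (M *v vector [s1, s2]) (vector [s1, s2])}"

definition density_quotient ::
  "('k::field \<Rightarrow> ereal) \<Rightarrow> 'k^2^2 \<Rightarrow> 'k \<Rightarrow> 'k \<Rightarrow> int \<Rightarrow> nat \<Rightarrow> real" where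
  "density_quotient ord G s1 s2 tm t =
     real (card (special_orthogonal_mod ord G s1 s2 tm t)) / real (norm_p ord) ^ t"

definition local_density_plus ::
  "('k::field \<Rightarrow> ereal) \<Rightarrow> 'k^2^2 \<Rightarrow> 'k \<Rightarrow> 'k \<Rightarrow> int \<Rightarrow> real" where
  "local_density_plus ord G s1 s2 tm = lim (density_quotient ord G s1 s2 tm)"

end

theory Submission
  imports Defs
begin

text \<open>
  The Gram and determinant congruences force \<open>M \<equiv> ((1 + z, - \<alpha> y), (y, 1 + z))\<close> with
  \<open>z\<^sup>2 + 2 z + \<alpha> y\<^sup>2 \<equiv> 0\<close> modulo \<open>\<pp>\<^bsup>t + e\<^esup>\<close>. Since \<open>- 2 z \<equiv> z\<^sup>2 + \<alpha> y\<^sup>2 = det (M - 1)\<close>, fixing the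
  primitive vector \<open>(s1, s2)\<close> modulo \<open>\<pp>\<^bsup>tm\<^esup>\<close> with \<open>tm > ord \<alpha> + e\<close> gives \<open>z \<in> \<pp>\<^bsup>tm\<^esup>\<close>, and then
  \<open>y \<in> \<pp>\<^sup>m\<close> for \<open>m = tm - min (ord \<alpha>) (ord s1)\<close>. Conversely each \<open>y \<in> \<pp>\<^sup>m\<close> determines exactly one
  such \<open>z\<close> modulo \<open>\<pp>\<^sup>t\<close>: with \<open>z = 2 w\<close> the equation is \<open>w\<^sup>2 + w + \<alpha> y\<^sup>2 / 4 = 0\<close>, of Hensel type.
  So \<open>N(\<pp>)\<^bsup>t - m\<^esup>\<close> classes remain, one for each class of \<open>\<pp>\<^sup>m\<close> modulo \<open>\<pp>\<^sup>t\<close>.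
\<close>

text \<open>
  A locale of its own, since \<^locale>\<open>padic_field\<close> contains two unqualified instances of
  \<^locale>\<open>normalized_valuation\<close>, in which constants declared there would clash.
\<close>
locale valued_field = normalized_valuation ord for ord :: "'a::field \<Rightarrow> ereal"
begin

section \<open>Fractional ideals of the valuation\<close>

definition pp :: "int \<Rightarrow> 'a set" where
  "pp n = {x. ereal (of_int n) \<le> ord x}"

lemma ord_cases:
  obtains "x = 0" "ord x = \<infinity>" | n where "x \<noteq> 0" "ord x = ereal (of_int n)"
  using ord_int ord_eq_infinity_iff by metis

lemma ord_1: "ord 1 = 0"
  using ord_mult[of 1 1] by (cases "1 :: 'a" rule: ord_cases) (auto simp: zero_ereal_def)

lemma ord_uminus: "ord (- x) = ord x"
proof -
  have "ord (-1) = 0"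
    using ord_mult[of "-1" "-1"] ord_1
    by (cases "-1 :: 'a" rule: ord_cases) (auto simp: zero_ereal_def)
  then show ?thesis using ord_mult[of "-1" x] by simp
qed

lemma zero_in_pp [simp]: "0 \<in> pp n"
  using ord_eq_infinity_iff[of 0] by (simp add: pp_def)

lemma pp_add: "x \<in> pp n \<Longrightarrow> y \<in> pp n \<Longrightarrow> x + y \<in> pp n"
  using ord_add[of x y] by (auto simp: pp_def min_def split: if_splits)

lemma pp_uminus: "- x \<in> pp n \<longleftrightarrow> x \<in> pp n"
  by (simp add: pp_def ord_uminus)

lemma pp_diff: "x \<in> pp n \<Longrightarrow> y \<in> pp n \<Longrightarrow> x - y \<in> pp n"
  using pp_add[of x n "- y"] by (simp add: pp_uminus)

lemma pp_mono: "x \<in> pp n \<Longrightarrow> m \<le> n \<Longrightarrow> x \<in> pp m"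
  unfolding pp_def by (auto intro: order_trans[of "ereal (of_int m)" "ereal (of_int n)"])

lemma pp_mult_add: "x \<in> pp m \<Longrightarrow> y \<in> pp n \<Longrightarrow> x * y \<in> pp (m + n)"
  using add_mono[of "ereal (of_int m)" "ord x" "ereal (of_int n)" "ord y"]
  by (simp add: pp_def ord_mult)

lemma pp_mult: "x \<in> pp m \<Longrightarrow> y \<in> pp n \<Longrightarrow> k \<le> m + n \<Longrightarrow> x * y \<in> pp k"
  using pp_mult_add pp_mono by blast

lemma pp_mult_left: "x \<in> pp 0 \<Longrightarrow> y \<in> pp n \<Longrightarrow> x * y \<in> pp n"
  by (rule pp_mult) auto

lemma pp_mult_right: "x \<in> pp n \<Longrightarrow> y \<in> pp 0 \<Longrightarrow> x * y \<in> pp n"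
  by (rule pp_mult) auto

lemma pp_if_ord_eq: "ord x = ereal (of_int n) \<Longrightarrow> x \<in> pp n"
  by (simp add: pp_def)

lemma pp_iff_if_ord_eq: "ord x = ereal (of_int n) \<Longrightarrow> x \<in> pp m \<longleftrightarrow> m \<le> n"
  by (simp add: pp_def)

lemma one_in_pp: "1 \<in> pp 0"
  by (simp add: pp_def ord_1)

lemma pp_cancel:
  assumes "ord u = ereal (of_int n)" "u * x \<in> pp m"
  shows "x \<in> pp (m - n)"
  using assms by (cases x rule: ord_cases) (auto simp: pp_def ord_mult)

lemma not_in_pp_obtain:
  assumes "x \<notin> pp n"
  obtains k where "ord x = ereal (of_int k)" "k < n"
  using assms by (cases x rule: ord_cases) (auto simp: pp_def)

text \<open>Ultrametric strictness: if the sum lay in \<open>pp (n + 1)\<close>, then so would x,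
  being the sum minus y.\<close>

lemma ord_add_dominant:
  assumes x: "ord x = ereal (of_int n)" and y: "y \<in> pp (n + 1)"
  shows "ord (x + y) = ereal (of_int n)"
proof -
  have in_pp: "x + y \<in> pp n"
    using x y by (intro pp_add) (auto intro: pp_if_ord_eq pp_mono)
  have notin: "x + y \<notin> pp (n + 1)"
  proof
    assume "x + y \<in> pp (n + 1)"
    from pp_diff[OF this y] show False by (simp add: pp_iff_if_ord_eq[OF x])
  qed
  from notin obtain k where k: "ord (x + y) = ereal (of_int k)" "k < n + 1"
    by (rule not_in_pp_obtain)
  with in_pp show ?thesis by (simp add: pp_iff_if_ord_eq)
qed

lemma exists_ord_eq: "\<exists>w. ord w = ereal (of_int n)"
proof (induction n rule: int_induct[where k = 0])
  case base
  then show ?case using ord_1 by (auto simp: zero_ereal_def)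
next
  case (step1 i)
  obtain q where "ord q = 1" using ord_normalized by blast
  obtain w where "ord w = ereal (of_int i)" using step1 by blast
  then have "ord (w * q) = ereal (of_int (i + 1))"
    using \<open>ord q = 1\<close> by (simp add: ord_mult one_ereal_def)
  then show ?case by blast
next
  case (step2 i)
  obtain q where q: "ord q = 1" using ord_normalized by blast
  obtain w where w: "ord w = ereal (of_int i)" using step2 by blast
  have "q \<noteq> 0" using q ord_eq_infinity_iff[of q] by auto
  then have "ord (w / q) + ord q = ereal (of_int i)"
    using ord_mult[of "w / q" q] w by simp
  then have "ord (w / q) = ereal (of_int (i - 1))"
    using q by (cases "ord (w / q)") (auto simp: one_ereal_def)
  then show ?case by blast
qed

section \<open>Residue classes and their number\<close>

abbreviation res :: "int \<Rightarrow> 'a \<Rightarrow> 'a set" where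
  "res n \<equiv> residue_class ord (ereal (of_int n))"

lemma cong_pow_iff: "cong_pow ord (ereal (of_int n)) x y \<longleftrightarrow> x - y \<in> pp n"
  by (simp add: cong_pow_def pp_def)

lemma res_eq_iff: "res n x = res n y \<longleftrightarrow> x - y \<in> pp n"
proof
  assume "res n x = res n y"
  moreover have "x \<in> res n x" by (simp add: residue_class_def cong_pow_iff)
  ultimately show "x - y \<in> pp n" by (auto simp: residue_class_def cong_pow_iff)
next
  assume "x - y \<in> pp n"
  then show "res n x = res n y"
    unfolding residue_class_def cong_pow_iff
    using pp_add[of "_ - x" n "x - y"] pp_diff[of "_ - y" n "x - y"] by auto
qed

lemma integer_ring_eq: "integer_ring ord = pp 0"
  by (simp add: integer_ring_def pp_def zero_ereal_def)

text \<open>Multiplication by an element of valuation n carries O/p bijectively onto p^n/p^(n+1).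
  The bijection starts from a set S of representatives, so that it acts on elements rather than on
  cosets.\<close>

lemma card_res_1:
  "card (res (n + 1) ` pp n) = norm_p ord"
proof -
  obtain w where w: "ord w = ereal (of_int n)" using exists_ord_eq by blast
  obtain S where S: "S \<subseteq> pp 0" "inj_on (res 1) S" "res 1 ` pp 0 = res 1 ` S"
    using subset_image_inj[of "res 1 ` pp 0" "res 1" "pp 0"] by auto
  have "bij_betw (\<lambda>s. res (n + 1) (w * s)) S (res (n + 1) ` pp n)"
    unfolding bij_betw_def
  proof (intro conjI inj_onI equalityI subsetI)
    fix s s' assume s: "s \<in> S" "s' \<in> S" and "res (n + 1) (w * s) = res (n + 1) (w * s')"
    then have "w * (s - s') \<in> pp (n + 1)" unfolding res_eq_iff by (simp add: algebra_simps)
    from pp_cancel[OF w this] have "res 1 s = res 1 s'" by (simp only: res_eq_iff add_diff_cancel_left')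
    with s S(2) show "s = s'" by (auto dest: inj_onD)
  next
    fix A assume "A \<in> (\<lambda>s. res (n + 1) (w * s)) ` S"
    then show "A \<in> res (n + 1) ` pp n"
      using S(1) pp_mult_right[OF pp_if_ord_eq[OF w]] by auto
  next
    fix A assume "A \<in> res (n + 1) ` pp n"
    then obtain x where x: "A = res (n + 1) x" "x \<in> pp n" by blast
    have w0: "w \<noteq> 0" using w ord_eq_infinity_iff[of w] by auto
    then have "x / w \<in> pp 0"
      using pp_cancel[OF w, of "x / w" n] x by simp
    then have "res 1 (x / w) \<in> res 1 ` S" unfolding S(3)[symmetric] by (rule imageI)
    then obtain s where s: "s \<in> S" "x / w - s \<in> pp 1"
      unfolding image_iff res_eq_iff by blast
    have "w * (x / w - s) \<in> pp (n + 1)"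
      using pp_if_ord_eq[OF w] s(2) by (rule pp_mult_add)
    then have "A = res (n + 1) (w * s)"
      unfolding x(1) res_eq_iff using w0 by (simp add: algebra_simps)
    with s show "A \<in> (\<lambda>s. res (n + 1) (w * s)) ` S" by blast
  qed
  then have "card (res (n + 1) ` pp n) = card S" by (simp add: bij_betw_same_card)
  also have "card S = card (res 1 ` pp 0)" using S by (simp add: card_image)
  finally show ?thesis by (simp add: norm_p_def integer_ring_eq one_ereal_def)
qed

text \<open>Induction along the chain of ideals: a class of p^n modulo p^(n+1+k) is uniquely s + u,
  with s a representative of p^n/p^(n+1) and u one of p^(n+1)/p^(n+1+k). The base n is kept
  arbitrary because the induction hypothesis is applied at n + 1.\<close>

lemma card_res: "card (res (n + int k) ` pp n) = norm_p ord ^ k"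
proof (induction k arbitrary: n)
  case 0
  have "res n x = res n 0" if "x \<in> pp n" for x
    using that by (simp only: res_eq_iff diff_zero)
  then have "res n ` pp n = (\<lambda>x. res n 0) ` pp n" by (rule image_cong[OF refl])
  also have "\<dots> = {res n 0}" using zero_in_pp by blast
  finally have "res n ` pp n = {res n 0}" .
  then show ?case by simp
next
  case (Suc k)
  obtain S where S: "S \<subseteq> pp n" "inj_on (res (n + 1)) S"
      "res (n + 1) ` pp n = res (n + 1) ` S"
    using subset_image_inj[of "res (n + 1) ` pp n" "res (n + 1)" "pp n"] by auto
  let ?t = "n + 1 + int k"
  obtain T where T: "T \<subseteq> pp (n + 1)" "inj_on (res ?t) T"
      "res ?t ` pp (n + 1) = res ?t ` T"
    using subset_image_inj[of "res ?t ` pp (n + 1)" "res ?t" "pp (n + 1)"] by auto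
  have "bij_betw (\<lambda>(s, u). res ?t (s + u)) (S \<times> T) (res ?t ` pp n)"
    unfolding bij_betw_def
  proof (intro conjI equalityI subsetI)
    show "inj_on (\<lambda>(s, u). res ?t (s + u)) (S \<times> T)"
    proof (rule inj_onI, clarify)
      fix s u s' u'
      assume in_ST: "s \<in> S" "u \<in> T" "s' \<in> S" "u' \<in> T" and "res ?t (s + u) = res ?t (s' + u')"
      then have d: "(s + u) - (s' + u') \<in> pp ?t" by (simp only: res_eq_iff)
      have "u - u' \<in> pp (n + 1)" using in_ST T(1) by (auto intro: pp_diff)
      from pp_diff[OF pp_mono[OF d, of "n + 1"] this] have "s - s' \<in> pp (n + 1)"
        by (simp add: algebra_simps)
      with in_ST S(2) have "s = s'" by (metis inj_onD res_eq_iff)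
      moreover from this d have "u - u' \<in> pp ?t" by simp
      with in_ST T(2) have "u = u'" by (metis inj_onD res_eq_iff)
      ultimately show "s = s' \<and> u = u'" by simp
    qed
  next
    fix A assume "A \<in> (\<lambda>(s, u). res ?t (s + u)) ` (S \<times> T)"
    then show "A \<in> res ?t ` pp n"
      using S(1) T(1) by (auto intro!: imageI pp_add intro: pp_mono[of _ "n + 1" n])
  next
    fix A assume "A \<in> res ?t ` pp n"
    then obtain x where x: "A = res ?t x" "x \<in> pp n" by blast
    then have "res (n + 1) x \<in> res (n + 1) ` S" unfolding S(3)[symmetric] by (rule_tac imageI)
    then obtain s where s: "s \<in> S" "x - s \<in> pp (n + 1)"
      unfolding image_iff res_eq_iff by blast
    then have "res ?t (x - s) \<in> res ?t ` T" unfolding T(3)[symmetric] by (rule_tac imageI)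
    then obtain u where u: "u \<in> T" "x - s - u \<in> pp ?t"
      unfolding image_iff res_eq_iff by blast
    then have "A = res ?t (s + u)" unfolding x(1) res_eq_iff by (simp add: algebra_simps)
    with s u show "A \<in> (\<lambda>(s, u). res ?t (s + u)) ` (S \<times> T)" by force
  qed
  from bij_betw_same_card[OF this] have "card (res ?t ` pp n) = card S * card T"
    by (simp add: card_cartesian_product)
  also have "card S = norm_p ord" using S card_res_1[of n] by (simp add: card_image)
  also have "card T = norm_p ord ^ k" using T Suc.IH[of "n + 1"] by (simp add: card_image)
  finally show ?case by (simp add: algebra_simps)
qed

section \<open>Congruences for the rotation coordinates z and y\<close>

text \<open>
  The iteration \<open>w \<mapsto> - (c + w\<^sup>2)\<close> contracts \<open>\<pp>\<close>; stopping after \<open>n\<close> steps avoids completeness.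
\<close>
lemma approximate_root:
  assumes c: "c \<in> pp k" and k: "1 \<le> k"
  shows "\<exists>w \<in> pp k. w\<^sup>2 + w + c \<in> pp (int n)"
proof (induction n)
  case 0
  have "c \<in> pp 0" using c k by (auto intro: pp_mono)
  then show ?case by (intro bexI[of _ 0]) auto
next
  case (Suc n)
  then obtain w where w: "w \<in> pp k" "w\<^sup>2 + w + c \<in> pp (int n)" by blast
  define w' where "w' = - (c + w * w)"
  have w': "w' \<in> pp k"
    unfolding w'_def pp_uminus using c w(1) k by (intro pp_add pp_mult) auto
  \<comment> \<open>By the choice of \<open>w'\<close>, the old value is w - w', and the new value
    is w'^2 - w^2. The extra factor w + w' lies in p^k with k at least 1, so each step gains at
    least one power of p.\<close>
  have eq: "w'\<^sup>2 + w' + c = (w\<^sup>2 + w + c) * - (w + w')"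
    by (simp add: w'_def power2_eq_square algebra_simps)
  have "w'\<^sup>2 + w' + c \<in> pp (int (Suc n))"
    unfolding eq using w(2) pp_add[OF w(1) w'] k
    by (rule_tac pp_mult[of _ "int n" _ k]) (auto simp: pp_uminus simp del: minus_add_distrib)
  with w' show ?case by blast
qed

text \<open>The last two hypotheses are the coordinates of (M - 1)(s1, s2) for the rotation M with
  entries 1 + z, - \<alpha> y, y, 1 + z. Multiplying the norm congruence by the square of the unit
  among s1, s2 rewrites z^2 + \<alpha> y^2 through these small coordinates, which bounds 2 z. The
  margin c > a + e pays for dividing by 2 and by the norm of (s1, s2).\<close>

lemma fixing_rotation_coords:
  assumes al: "ord \<alpha> = ereal (of_int a)" and a0: "0 \<le> a"
    and two: "ord 2 = ereal (of_int e)" and c: "a + e + 1 \<le> c" and e: "1 \<le> e"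
    and s: "s1 \<in> pp 0" "s2 \<in> pp 0" "ord s1 = 0 \<or> ord s2 = 0"
    and zy: "z \<in> pp 0" "y \<in> pp 0"
    and norm: "z\<^sup>2 + 2 * z + \<alpha> * y\<^sup>2 \<in> pp (2 * c)"
    and f: "z * s1 - \<alpha> * y * s2 \<in> pp c" and d: "y * s1 + z * s2 \<in> pp c"
  shows "z \<in> pp c \<and> \<alpha> * y \<in> pp c \<and> s1 * y \<in> pp c"
proof -
  define f' d' where "f' = z * s1 - \<alpha> * y * s2" and "d' = y * s1 + z * s2"
  have f': "f' \<in> pp c" and d': "d' \<in> pp c" using f d by (simp_all add: f'_def d'_def)
  have al0: "\<alpha> \<in> pp 0" and two0: "2 \<in> pp 0"
    using al two a0 e by (simp_all add: pp_iff_if_ord_eq)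
  note [intro] = pp_add pp_diff pp_mult_left pp_mult_right s(1,2) zy al0 two0 f' d'
  have unit_cancel: "x \<in> pp n" if "ord u = 0" "u * x \<in> pp n" for u x n
    using pp_cancel[of u 0 x n] that by (simp add: zero_ereal_def)
  have z: "z \<in> pp c"
  proof (rule ccontr)
    assume nz: "z \<notin> pp c"
    then obtain k where k: "ord z = ereal (of_int k)" "k < c" by (rule not_in_pp_obtain)
    have zk: "z \<in> pp k" using k(1) by (rule pp_if_ord_eq)
    have dk: "d' \<in> pp k" using d' k(2) by (auto intro: pp_mono)
    from s(3) show False
    proof
      assume u: "ord s1 = 0"
      \<comment> \<open>This is s1^2 (z^2 + \<alpha> y^2) after substituting y s1 = d' - z s2 and z
        s1 = f' + \<alpha> y s2. Comparison with the norm congruence puts 2 z in p^(k + c), hence c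
        \<le> e, a contradiction.\<close>
      have "z * (s1 * f' + \<alpha> * s2 * d') + \<alpha> * (d' * (d' - 2 * z * s2)) \<in> pp (k + c)"
        using pp_mult_add[OF zk, of "s1 * f' + \<alpha> * s2 * d'" c]
          pp_mult_add[of "d' - 2 * z * s2" k d' c] zk dk
        by (intro pp_add pp_mult_left[of \<alpha>]) (auto simp: mult.commute)
      moreover have "s1 * (s1 * (z\<^sup>2 + 2 * z + \<alpha> * y\<^sup>2)) \<in> pp (k + c)"
        using k(2) by (intro pp_mult_left s pp_mono[OF norm]) simp
      moreover have "s1 * (s1 * (z\<^sup>2 + 2 * z + \<alpha> * y\<^sup>2)) -
          (z * (s1 * f' + \<alpha> * s2 * d') + \<alpha> * (d' * (d' - 2 * z * s2))) = s1 * (s1 * (2 * z))"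
        by (simp add: f'_def d'_def power2_eq_square algebra_simps)
      ultimately have "s1 * (s1 * (2 * z)) \<in> pp (k + c)" using pp_diff by metis
      then have "2 * z \<in> pp (k + c)" using u unit_cancel by blast
      from pp_cancel[OF two this] show False using c a0 by (simp add: pp_iff_if_ord_eq[OF k(1)])
    next
      assume u: "ord s2 = 0"
      have "y \<notin> pp c"
      proof
        assume "y \<in> pp c"
        then have "d' - y * s1 \<in> pp c" by blast
        then have "s2 * z \<in> pp c" by (simp add: d'_def mult.commute)
        with u nz unit_cancel show False by blast
      qed
      then obtain l where l: "ord y = ereal (of_int l)" "l < c" by (rule not_in_pp_obtain)
      have yl: "y \<in> pp l" using l(1) by (rule pp_if_ord_eq)
      have dl: "d' \<in> pp l" using d' l(2) by (auto intro: pp_mono)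
      \<comment> \<open>The analogous elimination for s2^2 (z^2 + \<alpha> y^2), now with z s2 = d'
        - y s1. It bounds z relative to y only, so a separate bound on y must follow.\<close>
      have "y * (s1 * d' - s2 * f') + d' * (d' - 2 * y * s1) \<in> pp (l + c)"
        using pp_mult_add[OF yl, of "s1 * d' - s2 * f'" c]
          pp_mult_add[of "d' - 2 * y * s1" l d' c] yl dl
        by (intro pp_add) (auto simp: mult.commute)
      moreover have "s2 * (s2 * (z\<^sup>2 + 2 * z + \<alpha> * y\<^sup>2)) \<in> pp (l + c)"
        using l(2) by (intro pp_mult_left s pp_mono[OF norm]) simp
      moreover have "s2 * (s2 * (z\<^sup>2 + 2 * z + \<alpha> * y\<^sup>2)) -
          (y * (s1 * d' - s2 * f') + d' * (d' - 2 * y * s1)) = s2 * (s2 * (2 * z))"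
        by (simp add: f'_def d'_def power2_eq_square algebra_simps)
      ultimately have "s2 * (s2 * (2 * z)) \<in> pp (l + c)" using pp_diff by metis
      then have "2 * z \<in> pp (l + c)" using u unit_cancel by blast
      from pp_cancel[OF two this] have kl: "l + c - e \<le> k" by (simp add: pp_iff_if_ord_eq[OF k(1)])
      have "d' - z * s2 \<in> pp k" using zk dk by blast
      then have "y * s1 \<in> pp k" by (simp add: d'_def)
      \<comment> \<open>Here k - l is at least c - e, which exceeds a. With s1 this small and s2 a
        unit, s1^2 + \<alpha> s2^2 has valuation exactly a.\<close>
      from pp_cancel[OF l(1) this] have "s1 \<in> pp (a + 1)" using kl c by (auto intro: pp_mono)
      then have "s1 * s1 \<in> pp (a + 1)" by blast
      moreover have "ord (\<alpha> * s2 * s2) = ereal (of_int a)" using al u by (simp add: ord_mult)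
      ultimately have ord_nu: "ord (\<alpha> * s2 * s2 + s1 * s1) = ereal (of_int a)"
        by (rule_tac ord_add_dominant)
      \<comment> \<open>This combination eliminates z and leaves the norm of (s1, s2) times y. So l
        is at least c - a, whence k is at least 2 c - a - e > c, contrary to k < c.\<close>
      have "s1 * d' - s2 * f' \<in> pp c" by blast
      then have "(\<alpha> * s2 * s2 + s1 * s1) * y \<in> pp c"
        by (simp add: f'_def d'_def algebra_simps)
      from pp_cancel[OF ord_nu this] have "c - a \<le> l" by (simp add: pp_iff_if_ord_eq[OF l(1)])
      with kl k(2) c show False by simp
    qed
  qed
  have "d' - z * s2 \<in> pp c" "z * s1 - f' \<in> pp c" using z by blast+
  then have *: "s1 * y \<in> pp c" "s2 * (\<alpha> * y) \<in> pp c"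
    by (simp_all add: d'_def f'_def algebra_simps)
  then have "\<alpha> * y \<in> pp c" using s(3) unit_cancel by blast
  with z * show ?thesis by simp
qed

text \<open>Subtracting the two congruences factors the difference as (2 + z + z')(z - z') plus
  \<alpha> (y - y')(y + y'). Since z and z' lie in p^(e+1), the factor 2 + z + z' has valuation
  exactly e, and y + y' in p^e supplies the precision lost by cancelling it. The bound on z also
  excludes the second root, - 2 - z.\<close>

lemma root_unique_mod:
  assumes two: "ord 2 = ereal (of_int e)" and \<alpha>: "\<alpha> \<in> pp 0"
    and z: "z \<in> pp (e + 1)" "z' \<in> pp (e + 1)" and y: "y \<in> pp e" "y' \<in> pp e"
    and yy: "y - y' \<in> pp t"
    and norm: "z\<^sup>2 + 2 * z + \<alpha> * y\<^sup>2 \<in> pp (t + e)" "z'\<^sup>2 + 2 * z' + \<alpha> * y'\<^sup>2 \<in> pp (t + e)"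
  shows "z - z' \<in> pp t"
proof -
  have "\<alpha> * ((y - y') * (y + y')) \<in> pp (t + e)"
    using y yy \<alpha> by (intro pp_mult_left pp_mult_add pp_add)
  then have "(z\<^sup>2 + 2 * z + \<alpha> * y\<^sup>2) - (z'\<^sup>2 + 2 * z' + \<alpha> * y'\<^sup>2) - \<alpha> * ((y - y') * (y + y')) \<in> pp (t + e)"
    using norm by (intro pp_diff)
  then have "(2 + (z + z')) * (z - z') \<in> pp (t + e)"
    by (simp add: power2_eq_square algebra_simps)
  moreover have "ord (2 + (z + z')) = ereal (of_int e)"
    using two z by (intro ord_add_dominant pp_add)
  ultimately show ?thesis using pp_cancel by fastforce
qed

text \<open>Putting z = 2 w and b = \<alpha> y^2 / 4 turns the expression into 4 (w^2 + w + b). The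
  bound on m is what places b in p, so that \<open>approximate_root\<close> applies.\<close>

lemma root_exists_mod:
  assumes two: "ord 2 = ereal (of_int e)" and e: "1 \<le> e" and \<alpha>: "\<alpha> \<in> pp a"
    and y: "y \<in> pp m" and m: "2 * e + 1 \<le> a + 2 * m"
  shows "\<exists>z \<in> pp (a + 2 * m - e). z\<^sup>2 + 2 * z + \<alpha> * y\<^sup>2 \<in> pp (int n)"
proof -
  have two0: "(2 :: 'a) \<noteq> 0" using two ord_eq_infinity_iff[of 2] by auto
  have two_e: "2 \<in> pp e" using two by (rule pp_if_ord_eq)
  define b where "b = inverse 2 * (inverse 2 * (\<alpha> * y\<^sup>2))"
  have cancel: "2 * (inverse 2 * x) = x" for x :: 'a
    unfolding mult.assoc[symmetric] right_inverse[OF two0] by (rule mult_1)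
  have b4: "2 * (2 * b) = \<alpha> * y\<^sup>2" by (simp only: b_def cancel)
  have "\<alpha> * (y * y) \<in> pp (a + (m + m))" using \<alpha> y by (intro pp_mult_add)
  then have "2 * (2 * b) \<in> pp (a + 2 * m)" unfolding b4 by (simp add: power2_eq_square)
  then have "b \<in> pp (a + 2 * m - e - e)" using pp_cancel[OF two] by blast
  then obtain w where w: "w \<in> pp (a + 2 * m - e - e)" "w\<^sup>2 + w + b \<in> pp (int n)"
    using approximate_root[of b "a + 2 * m - e - e" n] m by auto
  have "2 * w \<in> pp (a + 2 * m - e)" using two_e w(1) by (rule pp_mult) simp
  moreover have "2 * (2 * (w\<^sup>2 + w + b)) \<in> pp (int n)"
    using two_e e w(2) by (intro pp_mult_left) (auto intro: pp_mono)
  then have "(2 * w)\<^sup>2 + 2 * (2 * w) + \<alpha> * y\<^sup>2 \<in> pp (int n)"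
    unfolding b4[symmetric] by (simp add: power2_eq_square algebra_simps)
  ultimately show ?thesis by blast
qed

text \<open>For exact equations, M^T G M = G and det M = 1 give G M = adj(M)^T G, and comparing
  entries yields the claim. The combinations below carry this out modulo p^n without
  division.\<close>

lemma rotation_entries:
  assumes "x \<in> pp 0" "y \<in> pp 0" "u \<in> pp 0" "w \<in> pp 0" "\<alpha> \<in> pp 0"
    and F: "x * x + \<alpha> * y * y - 1 \<in> pp n" and E: "x * u + \<alpha> * y * w \<in> pp n"
    and D: "x * w - u * y - 1 \<in> pp n"
  shows "w - x \<in> pp n" "u + \<alpha> * y \<in> pp n"
proof -
  note [intro] = pp_add pp_diff pp_mult_left assms
  have "x * (x * w - u * y - 1) + y * (x * u + \<alpha> * y * w) - w * (x * x + \<alpha> * y * y - 1) \<in> pp n"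
    by blast
  then show "w - x \<in> pp n" by (simp add: algebra_simps)
  have "x * (x * u + \<alpha> * y * w) - u * (x * x + \<alpha> * y * y - 1) - \<alpha> * (y * (x * w - u * y - 1)) \<in> pp n"
    by blast
  then show "u + \<alpha> * y \<in> pp n" by (simp add: algebra_simps)
qed

section \<open>The special orthogonal group modulo p^t and its order\<close>

abbreviation mat2 :: "'a \<Rightarrow> 'a \<Rightarrow> 'a \<Rightarrow> 'a \<Rightarrow> 'a^2^2" where
  "mat2 x u y w \<equiv> vector [vector [x, u], vector [y, w]]"

lemma mat2_eta: "M = mat2 (M $ 1 $ 1) (M $ 1 $ 2) (M $ 2 $ 1) (M $ 2 $ 2)"
  by (simp add: vec_eq_iff forall_2)

lemma integral_mat2:
  "mat2 x u y w \<in> integral_matrices ord \<longleftrightarrow> x \<in> pp 0 \<and> u \<in> pp 0 \<and> y \<in> pp 0 \<and> w \<in> pp 0"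
  by (auto simp: integral_matrices_def forall_2 integer_ring_eq)

lemma mat_reduce_mat2_eq_iff:
  "mat_reduce ord (ereal (of_int t)) (mat2 x u y w) = mat_reduce ord (ereal (of_int t)) (mat2 x' u' y' w') \<longleftrightarrow>
    x - x' \<in> pp t \<and> u - u' \<in> pp t \<and> y - y' \<in> pp t \<and> w - w' \<in> pp t"
  by (auto simp: mat_reduce_def vec_eq_iff forall_2 res_eq_iff)

lemma mat_cong_gram_mat2:
  "mat_cong ord (ereal (of_int n)) (transpose (mat2 x u y w) ** diag2 1 \<alpha> ** mat2 x u y w) (diag2 1 \<alpha>) \<longleftrightarrow>
    x * x + \<alpha> * y * y - 1 \<in> pp n \<and> x * u + \<alpha> * y * w \<in> pp n \<and> u * u + \<alpha> * w * w - \<alpha> \<in> pp n"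
  by (auto simp: mat_cong_def forall_2 cong_pow_iff diag2_def matrix_matrix_mult_def transpose_def
      sum_2 algebra_simps)

text \<open>The Gram and determinant conditions collapse to one norm congruence, and the
  fixed-vector condition splits into separate conditions on z and y. The bound 2 c \<le> t makes the
  norm congruence strong enough for \<open>fixing_rotation_coords\<close>.\<close>

lemma special_orthogonal_mod_iff:
  assumes al: "ord \<alpha> = ereal (of_int a)" and a0: "0 \<le> a"
    and two: "ord 2 = ereal (of_int e)" and c: "a + e + 1 \<le> c" and e: "1 \<le> e"
    and s: "s1 \<in> pp 0" "s2 \<in> pp 0" "ord s1 = 0 \<or> ord s2 = 0"
    and t: "2 * c \<le> int t"
  shows "A \<in> special_orthogonal_mod ord (diag2 1 \<alpha>) s1 s2 c t \<longleftrightarrow>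
    (\<exists>z \<in> pp c. \<exists>y \<in> pp 0. \<alpha> * y \<in> pp c \<and> s1 * y \<in> pp c \<and>
      z\<^sup>2 + 2 * z + \<alpha> * y\<^sup>2 \<in> pp (int t + e) \<and>
      A = mat_reduce ord (ereal (of_int (int t))) (mat2 (1 + z) (- (\<alpha> * y)) y (1 + z)))"
    (is "_ = ?R")
proof -
  have al0: "\<alpha> \<in> pp 0" using al a0 by (simp add: pp_iff_if_ord_eq)
  have te: "ereal (real t) = ereal (of_int (int t))" "ereal (of_int (int t)) + ord 2 = ereal (of_int (int t + e))"
    using two by simp_all
  note [intro] = pp_add pp_diff pp_mult_left pp_mult_right s(1,2) al0 one_in_pp
  show ?thesis
  proof
    assume "A \<in> special_orthogonal_mod ord (diag2 1 \<alpha>) s1 s2 c t"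
    then obtain M where "M \<in> integral_matrices ord"
        "A = mat_reduce ord (ereal (of_int (int t))) M"
        "mat_cong ord (ereal (of_int (int t + e))) (transpose M ** diag2 1 \<alpha> ** M) (diag2 1 \<alpha>)"
        "cong_pow ord (ereal (of_int (int t + e))) (det M) 1"
        "vec_cong ord (ereal (of_int c)) (M *v vector [s1, s2]) (vector [s1, s2])"
      unfolding special_orthogonal_mod_def te by blast
    moreover obtain x u y w where "M = mat2 x u y w" using mat2_eta by blast
    ultimately have M: "x \<in> pp 0" "u \<in> pp 0" "y \<in> pp 0" "w \<in> pp 0"
        "A = mat_reduce ord (ereal (of_int (int t))) (mat2 x u y w)"
      and F: "x * x + \<alpha> * y * y - 1 \<in> pp (int t + e)"
      and E: "x * u + \<alpha> * y * w \<in> pp (int t + e)" and D: "x * w - u * y - 1 \<in> pp (int t + e)"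
      and fix1: "x * s1 + u * s2 - s1 \<in> pp c" and fix2: "y * s1 + w * s2 - s2 \<in> pp c"
      by (simp_all only: mat_cong_gram_mat2 integral_mat2 cong_pow_iff det_2 vec_cong_def forall_2
          matrix_vector_mult_def sum_2 vector_2 vec_lambda_beta)
    have xw: "w - x \<in> pp (int t + e)" and uy: "u + \<alpha> * y \<in> pp (int t + e)"
      using rotation_entries[OF M(1,3,2,4) al0 F E D] by auto
    have "c \<le> int t + e" using t c a0 e by linarith
    with xw uy have xwc: "w - x \<in> pp c" and uyc: "u + \<alpha> * y \<in> pp c" by (auto intro: pp_mono)
    have z: "x - 1 \<in> pp 0" using M by blast
    have norm: "(x - 1)\<^sup>2 + 2 * (x - 1) + \<alpha> * y\<^sup>2 \<in> pp (int t + e)"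
      using F by (simp add: power2_eq_square algebra_simps)
    have "(x * s1 + u * s2 - s1) - s2 * (u + \<alpha> * y) \<in> pp c"
      using fix1 uyc by blast
    then have fix1': "(x - 1) * s1 - \<alpha> * y * s2 \<in> pp c" by (simp add: algebra_simps)
    have "(y * s1 + w * s2 - s2) - s2 * (w - x) \<in> pp c"
      using fix2 xwc by blast
    then have fix2': "y * s1 + (x - 1) * s2 \<in> pp c" by (simp add: algebra_simps)
    have norm': "(x - 1)\<^sup>2 + 2 * (x - 1) + \<alpha> * y\<^sup>2 \<in> pp (2 * c)"
      using norm t e by (auto intro: pp_mono)
    have "x - 1 \<in> pp c \<and> \<alpha> * y \<in> pp c \<and> s1 * y \<in> pp c"
      by (rule fixing_rotation_coords[OF al a0 two c e s z M(3) norm' fix1' fix2'])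
    moreover have "A = mat_reduce ord (ereal (of_int (int t))) (mat2 (1 + (x - 1)) (- (\<alpha> * y)) y (1 + (x - 1)))"
      unfolding M(5) mat_reduce_mat2_eq_iff using pp_mono[OF xw, of "int t"] pp_mono[OF uy, of "int t"] e
      by (simp add: algebra_simps)
    ultimately show ?R using norm M(3) by blast
  next
    assume ?R
    then obtain z y where z: "z \<in> pp c" and y: "y \<in> pp 0" "\<alpha> * y \<in> pp c" "s1 * y \<in> pp c"
      and norm: "z\<^sup>2 + 2 * z + \<alpha> * y\<^sup>2 \<in> pp (int t + e)"
      and A: "A = mat_reduce ord (ereal (of_int (int t))) (mat2 (1 + z) (- (\<alpha> * y)) y (1 + z))"
      by blast
    let ?M = "mat2 (1 + z) (- (\<alpha> * y)) y (1 + z)"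
    \<comment> \<open>The adjugate of \<open>?M\<close>; it is an inverse modulo p^t because the
      determinant is 1 there.\<close>
    let ?N = "mat2 (1 + z) (\<alpha> * y) (- y) (1 + z)"
    have z0: "z \<in> pp 0" using z c a0 e by (auto intro: pp_mono)
    have int: "?M \<in> integral_matrices ord" "?N \<in> integral_matrices ord"
      unfolding integral_mat2 using z0 y by (auto simp: pp_uminus)
    have norm_t: "z\<^sup>2 + 2 * z + \<alpha> * y\<^sup>2 \<in> pp (int t)" using norm e by (auto intro: pp_mono)
    have inv: "mat_cong ord (ereal (of_int (int t))) (?M ** ?N) (mat 1)"
        "mat_cong ord (ereal (of_int (int t))) (?N ** ?M) (mat 1)"
      unfolding mat_cong_def forall_2 cong_pow_iff using norm_t
      by (simp_all add: matrix_matrix_mult_def sum_2 mat_def power2_eq_square algebra_simps)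
    have "\<alpha> * (z\<^sup>2 + 2 * z + \<alpha> * y\<^sup>2) \<in> pp (int t + e)" using norm by blast
    with norm have gram: "mat_cong ord (ereal (of_int (int t + e))) (transpose ?M ** diag2 1 \<alpha> ** ?M) (diag2 1 \<alpha>)"
      unfolding mat_cong_gram_mat2 by (simp add: power2_eq_square algebra_simps)
    have det: "cong_pow ord (ereal (of_int (int t + e))) (det ?M) 1"
      unfolding cong_pow_iff det_2 using norm by (simp add: power2_eq_square algebra_simps)
    have "s1 * z - s2 * (\<alpha> * y) \<in> pp c" "s1 * y + s2 * z \<in> pp c" using z y by blast+
    then have vec: "vec_cong ord (ereal (of_int c)) (?M *v vector [s1, s2]) (vector [s1, s2])"
      unfolding vec_cong_def forall_2 cong_pow_iff
      by (simp add: matrix_vector_mult_def sum_2 algebra_simps)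
    show "A \<in> special_orthogonal_mod ord (diag2 1 \<alpha>) s1 s2 c t"
      unfolding special_orthogonal_mod_def GL2_mod_def te using A int inv gram det vec by blast
  qed
qed

text \<open>A class is recovered from its lower left entry y: z is unique by
  \<open>root_unique_mod\<close> and exists for every y in p^m by \<open>root_exists_mod\<close>.
  What remains is to count p^m modulo p^t.\<close>

lemma card_special_orthogonal_mod:
  assumes al: "ord \<alpha> = ereal (of_int a)" and a0: "0 \<le> a"
    and two: "ord 2 = ereal (of_int e)" and c: "a + e + 1 \<le> c" and e: "1 \<le> e"
    and s: "s1 \<in> pp 0" "s2 \<in> pp 0" "ord s1 = 0 \<or> ord s2 = 0"
    and t: "2 * c \<le> int t"
    and \<mu>: "min (ord \<alpha>) (ord s1) = ereal (of_int \<mu>)"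
  shows "card (special_orthogonal_mod ord (diag2 1 \<alpha>) s1 s2 c t) = norm_p ord ^ nat (int t - c + \<mu>)"
proof -
  let ?SO = "special_orthogonal_mod ord (diag2 1 \<alpha>) s1 s2 c t"
  define m where "m = c - \<mu>"
  have \<mu>_a: "\<mu> \<le> a" using \<mu> al by (metis ereal_less_eq(3) min.cobounded1 of_int_le_iff)
  have \<mu>_0: "0 \<le> \<mu>"
  proof -
    have "ereal (of_int 0) \<le> min (ord \<alpha>) (ord s1)"
      using al a0 s(1) by (simp add: pp_def)
    then show ?thesis by (simp add: \<mu>)
  qed
  have al_pp: "\<alpha> \<in> pp a" "\<alpha> \<in> pp \<mu>" "\<alpha> \<in> pp 0"
    using \<mu>_a a0 by (simp_all add: pp_iff_if_ord_eq[OF al])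
  have s1_pp: "s1 \<in> pp \<mu>" unfolding pp_def using \<mu> by (metis mem_Collect_eq min.cobounded2)
  \<comment> \<open>One of \<alpha>, s1 has valuation exactly \<mu>, so its condition is the
    stronger one and gives y in p^(c - \<mu>); integrality of y then follows from \<mu> < c.\<close>
  have m_pp: "y \<in> pp 0 \<and> \<alpha> * y \<in> pp c \<and> s1 * y \<in> pp c \<longleftrightarrow> y \<in> pp m" for y
  proof
    assume y: "y \<in> pp 0 \<and> \<alpha> * y \<in> pp c \<and> s1 * y \<in> pp c"
    from \<mu> have "ord \<alpha> = ereal (of_int \<mu>) \<or> ord s1 = ereal (of_int \<mu>)"
      by (auto simp: min_def split: if_splits)
    with y show "y \<in> pp m" unfolding m_def using pp_cancel by blast
  next
    assume y: "y \<in> pp m"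
    then have "y \<in> pp 0" using \<mu>_a c e by (auto simp: m_def intro: pp_mono)
    moreover have "\<alpha> * y \<in> pp c" "s1 * y \<in> pp c"
      using pp_mult_add[OF al_pp(2) y] pp_mult_add[OF s1_pp y] by (simp_all add: m_def)
    ultimately show "y \<in> pp 0 \<and> \<alpha> * y \<in> pp c \<and> s1 * y \<in> pp c" by blast
  qed
  have SO: "A \<in> ?SO \<longleftrightarrow> (\<exists>z \<in> pp c. \<exists>y \<in> pp m. z\<^sup>2 + 2 * z + \<alpha> * y\<^sup>2 \<in> pp (int t + e) \<and>
      A = mat_reduce ord (ereal (of_int (int t))) (mat2 (1 + z) (- (\<alpha> * y)) y (1 + z)))" for A
    unfolding special_orthogonal_mod_iff[OF al a0 two c e s t] using m_pp by blast
  have "bij_betw (\<lambda>A. A $ 2 $ 1) ?SO (res (int t) ` pp m)"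
    unfolding bij_betw_def
  proof (intro conjI equalityI subsetI)
    show "inj_on (\<lambda>A. A $ 2 $ 1) ?SO"
    proof (rule inj_onI)
      fix A A' assume "A \<in> ?SO" "A' \<in> ?SO" and eq: "A $ 2 $ 1 = A' $ 2 $ 1"
      then obtain z y z' y' where z: "z \<in> pp c" "z' \<in> pp c" and y: "y \<in> pp m" "y' \<in> pp m"
        and norm: "z\<^sup>2 + 2 * z + \<alpha> * y\<^sup>2 \<in> pp (int t + e)" "z'\<^sup>2 + 2 * z' + \<alpha> * y'\<^sup>2 \<in> pp (int t + e)"
        and A: "A = mat_reduce ord (ereal (of_int (int t))) (mat2 (1 + z) (- (\<alpha> * y)) y (1 + z))"
          "A' = mat_reduce ord (ereal (of_int (int t))) (mat2 (1 + z') (- (\<alpha> * y')) y' (1 + z'))"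
        unfolding SO by blast
      have yy: "y - y' \<in> pp (int t)" using eq by (simp add: A mat_reduce_def res_eq_iff[symmetric])
      have "z - z' \<in> pp (int t)"
        using two al_pp(3) _ _ _ _ yy norm
        by (rule root_unique_mod) (use z y c a0 \<mu>_a in \<open>auto simp: m_def intro: pp_mono\<close>)
      moreover have "- (\<alpha> * (y - y')) \<in> pp (int t)"
        unfolding pp_uminus using al_pp(3) yy by (rule pp_mult_left)
      ultimately show "A = A'"
        unfolding A mat_reduce_mat2_eq_iff using yy by (simp add: algebra_simps)
    qed
  next
    fix C assume "C \<in> (\<lambda>A. A $ 2 $ 1) ` ?SO"
    then show "C \<in> res (int t) ` pp m" by (auto simp: SO mat_reduce_def)
  next
    fix C assume "C \<in> res (int t) ` pp m"
    then obtain y where y: "y \<in> pp m" "C = res (int t) y" by blast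
    have "2 * e + 1 \<le> a + 2 * m" using c \<mu>_a a0 e by (simp add: m_def)
    from root_exists_mod[OF two e al_pp(1) y(1) this, of "t + nat e"] e
    obtain z where z: "z \<in> pp (a + 2 * m - e)" "z\<^sup>2 + 2 * z + \<alpha> * y\<^sup>2 \<in> pp (int t + e)" by auto
    \<comment> \<open>The constructed root is deep enough: from \<mu> \<le> a and a + e < c, the
      exponent a + 2 m - e is at least c.\<close>
    have "z \<in> pp c" using z(1) by (rule pp_mono) (use c \<mu>_a a0 e in \<open>simp add: m_def\<close>)
    with z(2) y show "C \<in> (\<lambda>A. A $ 2 $ 1) ` ?SO"
      by (intro image_eqI[of _ _ "mat_reduce ord (ereal (of_int (int t))) (mat2 (1 + z) (- (\<alpha> * y)) y (1 + z))"])
        (auto simp: SO mat_reduce_def)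
  qed
  from bij_betw_same_card[OF this] have "card ?SO = card (res (int t) ` pp m)" .
  also have "int t = m + int (nat (int t - c + \<mu>))"
    using t \<mu>_0 c a0 e by (simp add: m_def)
  also have "card (res \<dots> ` pp m) = norm_p ord ^ nat (int t - c + \<mu>)" by (rule card_res)
  finally show ?thesis .
qed

section \<open>The limit and its exponent\<close>

text \<open>If the residue field were infinite, \<^const>\<open>norm_p\<close> would be \<open>0\<close> and both sides would vanish.\<close>
lemma density_quotient_tendsto:
  assumes al: "ord \<alpha> = ereal (of_int a)" and a0: "0 \<le> a"
    and two: "ord 2 = ereal (of_int e)" and c: "a + e + 1 \<le> c" and e: "1 \<le> e"
    and s: "s1 \<in> pp 0" "s2 \<in> pp 0" "ord s1 = 0 \<or> ord s2 = 0"
    and \<mu>: "min (ord \<alpha>) (ord s1) = ereal (of_int \<mu>)"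
  shows "density_quotient ord (diag2 1 \<alpha>) s1 s2 c
    \<longlonglongrightarrow> real (norm_p ord) powr of_int (\<mu> - c)"
proof (rule tendsto_eventually, rule eventually_sequentiallyI)
  \<comment> \<open>The quotient is constant from this threshold on. The summand 1 secures 0 < t,
    hence 0 ^ t = 0 when \<open>norm_p ord\<close> is 0.\<close>
  fix t assume "nat (2 * c) + 1 \<le> t"
  then have t: "2 * c \<le> int t" "0 < t" by linarith+
  show "density_quotient ord (diag2 1 \<alpha>) s1 s2 c t = real (norm_p ord) powr of_int (\<mu> - c)"
  proof (cases "norm_p ord = 0")
    case True
    then show ?thesis using t by (simp add: density_quotient_def)
  next
    case False
    have "ereal (of_int 0) \<le> min (ord \<alpha>) (ord s1)"
      using al a0 s(1) by (simp add: pp_def)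
    then have \<mu>_0: "0 \<le> \<mu>" by (simp add: \<mu>)
    have "density_quotient ord (diag2 1 \<alpha>) s1 s2 c t =
        real (norm_p ord) ^ nat (int t - c + \<mu>) / real (norm_p ord) ^ t"
      by (simp add: density_quotient_def card_special_orthogonal_mod[OF al a0 two c e s t(1) \<mu>])
    also have "\<dots> = real (norm_p ord) powr (real (nat (int t - c + \<mu>)) - real t)"
      using False by (simp add: powr_diff powr_realpow)
    also have "real (nat (int t - c + \<mu>)) - real t = of_int (\<mu> - c)"
      using \<mu>_0 t c a0 e by simp
    finally show ?thesis .
  qed
qed

text \<open>Translates the count, which involves ord \<alpha>, into the stated exponent. If s1 is a
  unit, both minima are 0. Otherwise s2 is a unit, and ord \<alpha> is compared with 2 ord
  s1.\<close>

lemma min_ord_norm: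
  assumes al: "ord \<alpha> = ereal (of_int a)" and a0: "0 \<le> a"
    and s: "s1 \<in> pp 0" "s2 \<in> pp 0" "ord s1 = 0 \<or> ord s2 = 0"
  shows "min (ord (s1\<^sup>2 + \<alpha> * s2\<^sup>2)) (ord s1) = min (ord \<alpha>) (ord s1)"
proof (cases s1 rule: ord_cases)
  case 1
  then show ?thesis using s(3) al by (simp add: ord_mult power2_eq_square)
next
  case (2 b)
  have b0: "0 \<le> b" using s(1) by (simp add: pp_iff_if_ord_eq[OF 2(2)])
  have ss: "ord (s1\<^sup>2) = ereal (of_int (2 * b))" using 2 by (simp add: ord_mult power2_eq_square)
  have as: "\<alpha> * s2\<^sup>2 \<in> pp a"
    using pp_if_ord_eq[OF al] s(2) by (simp add: power2_eq_square pp_mult_right)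
  consider "b = 0" | "b \<noteq> 0" "2 * b = a" | "b \<noteq> 0" "2 * b < a" | "b \<noteq> 0" "a < 2 * b" by linarith
  then show ?thesis
  proof cases
    case 1
    have "s1\<^sup>2 + \<alpha> * s2\<^sup>2 \<in> pp 0"
      using pp_mono[OF pp_if_ord_eq[OF ss], of 0] pp_mono[OF as, of 0] b0 a0 by (simp add: pp_add)
    then show ?thesis using 1 2 al a0 by (simp add: pp_def zero_ereal_def min_def)
  next
    \<comment> \<open>The two terms have equal valuation and may cancel, but the sum and \<alpha>
      both stay in p^b, so both minima equal ord s1 = b.\<close>
    case 2
    have "s1\<^sup>2 + \<alpha> * s2\<^sup>2 \<in> pp b"
      using pp_mono[OF pp_if_ord_eq[OF ss], of b] pp_mono[OF as, of b] b0 2(2) by (simp add: pp_add)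
    moreover have "\<alpha> \<in> pp b" using b0 2 by (simp add: pp_iff_if_ord_eq[OF al])
    ultimately show ?thesis using \<open>ord s1 = _\<close> by (simp add: pp_def min_def)
  next
    case 3
    have "ord (s1\<^sup>2 + \<alpha> * s2\<^sup>2) = ereal (of_int (2 * b))"
      using ss as 3 by (intro ord_add_dominant) (auto intro: pp_mono)
    then show ?thesis using 2 al 3 b0 by (simp add: min_def)
  next
    case 4
    have "ord (\<alpha> * s2\<^sup>2) = ereal (of_int a)"
      using 2 4 s(3) al by (simp add: ord_mult power2_eq_square)
    then have "ord (\<alpha> * s2\<^sup>2 + s1\<^sup>2) = ereal (of_int a)"
      using pp_if_ord_eq[OF ss] 4 by (intro ord_add_dominant) (auto intro: pp_mono)
    then show ?thesis by (simp add: al add.commute)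
  qed
qed

end

theorem theorem3p4:
  fixes v :: "'q::field_char_0 \<Rightarrow> ereal" and p :: nat
    and ord :: "'k::field \<Rightarrow> ereal" and \<iota> :: "'q \<Rightarrow> 'k"
    and scale :: "'k \<Rightarrow> 'v::ab_group_add \<Rightarrow> 'v" and B :: "'v \<Rightarrow> 'v \<Rightarrow> 'k"
    and e1 e2 \<nu> :: 'v and L X :: "'v set"
    and \<pi> \<alpha> s1 s2 :: 'k and tm :: int and e t\<nu> ts :: ereal
  assumes "binary_lattice_coset v p ord \<iota> scale B e1 e2 L X \<nu> \<pi> tm s1 s2"
    and "e = ord 2" and "t\<nu> = ord (s1\<^sup>2 + \<alpha> * s2\<^sup>2)" and "ts = ord s1"
    and "1 \<le> ord 2"
    and "gram_matrix B e1 e2 = diag2 1 \<alpha>"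
    and "\<alpha> \<in> integer_ring ord"
    and "ord \<alpha> + e + 1 \<le> ereal (of_int tm)"
  shows "convergent (density_quotient ord (gram_matrix B e1 e2) s1 s2 tm) \<and>
    local_density_plus ord (gram_matrix B e1 e2) s1 s2 tm =
      real (norm_p ord) powr
        real_of_ereal (- ereal (of_int tm) + min (ereal (of_int tm)) (min t\<nu> ts))"
proof -
  interpret binary_lattice_coset v p ord \<iota> scale B e1 e2 L X \<nu> \<pi> tm s1 s2 by fact
  interpret valued_field ord ..
  have alpha: "\<alpha> \<in> pp 0" using assms(7) by (simp add: integer_ring_eq)
  have s: "s1 \<in> pp 0" "s2 \<in> pp 0" using s_integral by (simp_all add: integer_ring_eq)
  \<comment> \<open>A zero 2 or a zero \<alpha> would make the left side of the bound on
    \<open>tm\<close> infinite, so both valuations are integers.\<close>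
  obtain d where two: "ord 2 = ereal (of_int d)"
    using assms(2,8) by (cases "2 :: 'k" rule: ord_cases) (use alpha in \<open>auto simp: pp_def\<close>)
  obtain a where al: "ord \<alpha> = ereal (of_int a)"
    using assms(2,8) two by (cases \<alpha> rule: ord_cases) auto
  have a0: "0 \<le> a" using alpha by (simp add: pp_iff_if_ord_eq[OF al])
  have d1: "1 \<le> d" using assms(5) two by (simp add: one_ereal_def)
  have c: "a + d + 1 \<le> tm"
  proof -
    have "ereal (of_int (a + d + 1)) \<le> ereal (of_int tm)"
      using assms(2,8) by (simp add: al two one_ereal_def)
    then show ?thesis by (simp only: ereal_less_eq of_int_le_iff)
  qed
  obtain \<mu> where \<mu>: "min (ord \<alpha>) (ord s1) = ereal (of_int \<mu>)"
    using al by (cases s1 rule: ord_cases) (fastforce simp: min_def)+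
  have "min (ereal (of_int tm)) (min t\<nu> ts) = min (ereal (of_int tm)) (ereal (of_int \<mu>))"
    by (simp only: assms(3,4) min_ord_norm[OF al a0 s s_unit] \<mu>)
  also have "ereal (of_int \<mu>) \<le> ereal (of_int a)"
    unfolding \<mu>[symmetric] al[symmetric] by simp
  \<comment> \<open>From \<mu> \<le> a < \<open>tm\<close>, the term \<open>tm\<close> never attains
    the minimum.\<close>
  then have "min (ereal (of_int tm)) (ereal (of_int \<mu>)) = ereal (of_int \<mu>)"
    using c d1 by simp
  finally have exponent: "real_of_ereal (- ereal (of_int tm) + min (ereal (of_int tm)) (min t\<nu> ts)) = of_int (\<mu> - tm)"
    by simp
  have "density_quotient ord (gram_matrix B e1 e2) s1 s2 tm \<longlonglongrightarrow> real (norm_p ord) powr of_int (\<mu> - tm)"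
    unfolding assms(6) by (rule density_quotient_tendsto[OF al a0 two c d1 s s_unit \<mu>])
  then show ?thesis
    unfolding local_density_plus_def exponent by (auto simp: convergent_def limI)
qed

end
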